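(* Let $N$ and $H$ be finitely generated groups with computable F\o lner sets and let $\phi\colon H\to \mathrm{Aut}(N)$ be a homomorphism. Then the semidirect product $N\rtimes_\phi H$ has computable F\o lner sets.
   Context: For a group $\Gamma$ generated by a finite set $X$, let $\pi_{\Gamma,X}\colon \mathbb F_X\to\Gamma$ be the canonical epimorphism from the free group on $X$. For a positive integer $n$, an $n$-F\o lner set of $\Gamma$ (with respect to $X$) is a non-empty finite subset $F\subset\Gamma$ with $\frac{|F\setminus xF|}{|F|}\le n^{-1}$ for all $x\in X$. $\Gamma$ has computable F\o lner sets (with respect to $X$) if there is an algorithm which, on input $n$, outputs a finite subset $F\subset\mathbb F_X$ such that $\pi_{\Gamma,X}(F)$ is $n$-F\o lner for $\Gamma$. This property does not depend on the choice of the finite generating set. *)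

theory Defs
  imports Complex_Main "HOL-Library.Nat_Bijection" "HOL-Algebra.Bij"
    "HOL-Algebra.Generated_Groups"
begin

subsection \<open>Computable functions\<close>

text \<open>
  The total recursive functions, in the functional form due to Kleene: the closure of the initial
  functions under composition, primitive recursion and minimisation of regular functions.
  In \<^term>\<open>total_recursive k f\<close> only the values of \<^term>\<open>f\<close> on lists of length \<^term>\<open>k\<close> matter.
\<close>

inductive total_recursive :: "nat \<Rightarrow> (nat list \<Rightarrow> nat) \<Rightarrow> bool" where
  zero: "total_recursive k (\<lambda>xs. 0)"
| succ: "total_recursive 1 (\<lambda>xs. Suc (xs ! 0))"
| proj: "i < k \<Longrightarrow> total_recursive k (\<lambda>xs. xs ! i)"
| comp: "\<lbrakk>total_recursive (length gs) f; \<forall>g\<in>set gs. total_recursive k g\<rbrakk>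
    \<Longrightarrow> total_recursive k (\<lambda>xs. f (map (\<lambda>g. g xs) gs))"
| prim_rec: "\<lbrakk>total_recursive k f; total_recursive (Suc (Suc k)) g\<rbrakk>
    \<Longrightarrow> total_recursive (Suc k) (\<lambda>xs. rec_nat (f (tl xs)) (\<lambda>m r. g (m # r # tl xs)) (hd xs))"
| minimise: "\<lbrakk>total_recursive (Suc k) f; \<forall>xs. length xs = k \<longrightarrow> (\<exists>m. f (m # xs) = 0)\<rbrakk>
    \<Longrightarrow> total_recursive k (\<lambda>xs. LEAST m. f (m # xs) = 0)"

definition computable :: "(nat \<Rightarrow> nat) \<Rightarrow> bool" where
  "computable f \<longleftrightarrow> (\<exists>g. total_recursive 1 g \<and> (\<forall>n. f n = g [n]))"


subsection \<open>Free groups\<close>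

text \<open>
  The letter \<^term>\<open>(x, True)\<close> stands for the generator \<^term>\<open>x\<close> and \<^term>\<open>(x, False)\<close> for its
  formal inverse; the elements of the free group are the reduced words.
\<close>

type_synonym 'a word = "('a \<times> bool) list"

definition flip :: "'a \<times> bool \<Rightarrow> 'a \<times> bool" where
  "flip l = (fst l, \<not> snd l)"

definition reduced :: "'a word \<Rightarrow> bool" where
  "reduced w \<longleftrightarrow> successively (\<lambda>l l'. l' \<noteq> flip l) w"

fun red_cons :: "'a \<times> bool \<Rightarrow> 'a word \<Rightarrow> 'a word" where
  "red_cons l [] = [l]"
| "red_cons l (l' # w) = (if l' = flip l then w else l # l' # w)"

definition free_group :: "'a set \<Rightarrow> 'a word monoid" where
  "free_group X = \<lparr>carrier = {w. reduced w \<and> fst ` set w \<subseteq> X},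
     monoid.mult = foldr red_cons, one = []\<rparr>"

definition letter_value :: "('a, 'm) monoid_scheme \<Rightarrow> 'a \<times> bool \<Rightarrow> 'a" where
  "letter_value G l = (if snd l then fst l else inv\<^bsub>G\<^esub> (fst l))"

text \<open>
  The canonical homomorphism from the free group on a subset of \<^term>\<open>G\<close> to \<^term>\<open>G\<close>.
\<close>

definition word_value :: "('a, 'm) monoid_scheme \<Rightarrow> 'a word \<Rightarrow> 'a" where
  "word_value G w = foldr (\<lambda>l g. letter_value G l \<otimes>\<^bsub>G\<^esub> g) w \<one>\<^bsub>G\<^esub>"

lemma flip_flip [simp]: "flip (flip l) = l"
  by (simp add: flip_def)

lemma fst_flip [simp]: "fst (flip l) = fst l"
  by (simp add: flip_def)

lemma flip_neq [simp]: "flip l \<noteq> l" "l \<noteq> flip l"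
  by (cases l; simp add: flip_def)+

lemma reduced_Nil [simp]: "reduced []"
  by (simp add: reduced_def)

lemma reduced_Cons:
  "reduced (l # w) \<longleftrightarrow> reduced w \<and> (w = [] \<or> hd w \<noteq> flip l)"
  by (auto simp: reduced_def successively_Cons)

lemma reduced_red_cons: "reduced w \<Longrightarrow> reduced (red_cons l w)"
  by (cases w) (auto simp: reduced_Cons)

lemma red_cons_reduced: "reduced (l # w) \<Longrightarrow> red_cons l w = l # w"
  by (cases w) (auto simp: reduced_Cons)

lemma red_cons_flip: "reduced w \<Longrightarrow> red_cons l (red_cons (flip l) w) = w"
  by (cases w; cases "tl w") (auto simp: reduced_Cons)

lemma reduced_foldr: "reduced v \<Longrightarrow> reduced (foldr red_cons u v)"
  by (induction u) (auto simp: reduced_red_cons)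

lemma letters_red_cons: "fst ` set (red_cons l w) \<subseteq> insert (fst l) (fst ` set w)"
  by (cases w) auto

lemma letters_foldr:
  "fst ` set (foldr red_cons u v) \<subseteq> fst ` set u \<union> fst ` set v"
proof (induction u)
  case (Cons l u)
  show ?case
    using order_trans[OF letters_red_cons insert_mono[OF Cons.IH]] by simp
qed simp

lemma foldr_reduced: "reduced u \<Longrightarrow> foldr red_cons u [] = u"
  by (induction u) (auto simp: reduced_Cons red_cons_reduced)

lemma foldr_red_cons:
  assumes "reduced v"
  shows "foldr red_cons (red_cons l u) v = red_cons l (foldr red_cons u v)"
proof (cases u)
  case (Cons l' w)
  then show ?thesis
    using red_cons_flip[OF reduced_foldr[OF assms], of l w] by auto
qed simp

lemma foldr_assoc:
  assumes "reduced w"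
  shows "foldr red_cons (foldr red_cons u v) w = foldr red_cons u (foldr red_cons v w)"
  by (induction u) (simp_all add: foldr_red_cons assms)

lemma foldr_inverse:
  "foldr red_cons (rev (map flip u)) (foldr red_cons u []) = []"
proof (induction u)
  case (Cons l u)
  then show ?case
    using red_cons_flip[OF reduced_foldr[of "[]" u], of "flip l"] by simp
qed simp

lemma group_free_group: "group (free_group X)"
proof (rule groupI)
  fix u assume u: "u \<in> carrier (free_group X)"
  let ?v = "foldr red_cons (rev (map flip u)) []"
  have "?v \<in> carrier (free_group X)"
    using u order_trans[OF letters_foldr[of "rev (map flip u)" "[]"], of X]
    by (auto simp: free_group_def reduced_foldr image_image)
  moreover have "?v \<otimes>\<^bsub>free_group X\<^esub> u = \<one>\<^bsub>free_group X\<^esub>"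
    using u foldr_inverse[of u]
    by (simp add: free_group_def foldr_assoc foldr_reduced)
  ultimately show "\<exists>v\<in>carrier (free_group X). v \<otimes>\<^bsub>free_group X\<^esub> u = \<one>\<^bsub>free_group X\<^esub>"
    by blast
next
  fix u v assume uv: "u \<in> carrier (free_group X)" "v \<in> carrier (free_group X)"
  then have "fst ` set (foldr red_cons u v) \<subseteq> X"
    by (intro order_trans[OF letters_foldr]) (auto simp: free_group_def)
  with uv show "u \<otimes>\<^bsub>free_group X\<^esub> v \<in> carrier (free_group X)"
    by (simp add: free_group_def reduced_foldr)
next
  fix u v w assume "u \<in> carrier (free_group X)" "v \<in> carrier (free_group X)"
    "w \<in> carrier (free_group X)"
  then show "u \<otimes>\<^bsub>free_group X\<^esub> v \<otimes>\<^bsub>free_group X\<^esub> w = u \<otimes>\<^bsub>free_group X\<^esub> (v \<otimes>\<^bsub>free_group X\<^esub> w)"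
    by (simp add: free_group_def foldr_assoc)
next
  show "\<one>\<^bsub>free_group X\<^esub> \<in> carrier (free_group X)"
    by (simp add: free_group_def)
next
  fix u assume "u \<in> carrier (free_group X)"
  then show "\<one>\<^bsub>free_group X\<^esub> \<otimes>\<^bsub>free_group X\<^esub> u = u"
    by (simp add: free_group_def)
qed


subsection \<open>Computable Folner sets\<close>

definition finite_generating_set :: "('a, 'm) monoid_scheme \<Rightarrow> 'a set \<Rightarrow> bool" where
  "finite_generating_set G X \<longleftrightarrow> finite X \<and> X \<subseteq> carrier G \<and> generate G X = carrier G"

definition finitely_generated :: "('a, 'm) monoid_scheme \<Rightarrow> bool" where
  "finitely_generated G \<longleftrightarrow> (\<exists>X. finite_generating_set G X)"

definition folner_set :: "('a, 'm) monoid_scheme \<Rightarrow> 'a set \<Rightarrow> nat \<Rightarrow> 'a set \<Rightarrow> bool" where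
  "folner_set G X n F \<longleftrightarrow> F \<noteq> {} \<and> finite F \<and> F \<subseteq> carrier G \<and>
     (\<forall>x\<in>X. real (card (F - (x <#\<^bsub>G\<^esub> F))) / real (card F) \<le> inverse (real n))"

definition word_code :: "('a \<Rightarrow> nat) \<Rightarrow> 'a word \<Rightarrow> nat" where
  "word_code e w = list_encode (map (\<lambda>(x, b). prod_encode (e x, of_bool b)) w)"

text \<open>
  An algorithm producing finite sets of words over the finite alphabet \<^term>\<open>X\<close>: words are coded
  by numbers through a numbering \<^term>\<open>e\<close> of \<^term>\<open>X\<close>, and a finite set is output as the code of
  a list of (the codes of) its elements, in any order and possibly with repetitions. Any two
  numberings of the finite set \<^term>\<open>X\<close> differ by a permutation of \<^term>\<open>{..<card X}\<close>, so
  the choice of \<^term>\<open>e\<close> is immaterial.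
\<close>

definition computable_word_sets :: "'a set \<Rightarrow> (nat \<Rightarrow> 'a word set) \<Rightarrow> bool" where
  "computable_word_sets X F \<longleftrightarrow>
     (\<exists>e r. bij_betw e X {..<card X} \<and> computable r \<and>
        (\<forall>n. set (list_decode (r n)) = word_code e ` F n))"

text \<open>The value at \<^term>\<open>0::nat\<close> is a dummy: only positive inputs are meaningful.\<close>

definition computable_folner_sets_wrt :: "('a, 'm) monoid_scheme \<Rightarrow> 'a set \<Rightarrow> bool" where
  "computable_folner_sets_wrt G X \<longleftrightarrow>
     (\<exists>F. computable_word_sets X F \<and>
        (\<forall>n. finite (F n) \<and> F n \<subseteq> carrier (free_group X)) \<and>
        (\<forall>n\<ge>1. folner_set G X n (word_value G ` F n)))"

text \<open>
  The property does not depend on the finite generating set, so asking for one suffices.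
\<close>

definition has_computable_folner_sets :: "('a, 'm) monoid_scheme \<Rightarrow> bool" where
  "has_computable_folner_sets G \<longleftrightarrow>
     (\<exists>X. finite_generating_set G X \<and> computable_folner_sets_wrt G X)"


subsection \<open>Semidirect products\<close>

definition semidirect ::
  "('a, 'm) monoid_scheme \<Rightarrow> ('b, 'k) monoid_scheme \<Rightarrow> ('b \<Rightarrow> 'a \<Rightarrow> 'a) \<Rightarrow> ('a \<times> 'b) monoid" where
  "semidirect N H \<phi> = \<lparr>carrier = carrier N \<times> carrier H,
     monoid.mult = (\<lambda>(a, h) (b, k). (a \<otimes>\<^bsub>N\<^esub> \<phi> h b, h \<otimes>\<^bsub>H\<^esub> k)),
     one = (\<one>\<^bsub>N\<^esub>, \<one>\<^bsub>H\<^esub>)\<rparr>"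

context group
begin

lemma letter_value_closed: "fst l \<in> carrier G \<Longrightarrow> letter_value G l \<in> carrier G"
  by (simp add: letter_value_def)

lemma word_value_closed: "fst ` set w \<subseteq> carrier G \<Longrightarrow> word_value G w \<in> carrier G"
  by (induction w) (auto simp: word_value_def letter_value_closed)

lemma word_value_red_cons:
  assumes "fst l \<in> carrier G" "fst ` set w \<subseteq> carrier G"
  shows "word_value G (red_cons l w) = letter_value G l \<otimes> word_value G w"
proof (cases w)
  case (Cons l' v)
  have v: "word_value G v \<in> carrier G"
    using assms Cons by (intro word_value_closed) auto
  have "letter_value G l \<otimes> (letter_value G (flip l) \<otimes> word_value G v) = word_value G v"
    using assms(1) v by (auto simp: letter_value_def flip_def m_assoc[symmetric])
  then show ?thesis
    using Cons by (auto simp: word_value_def)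
qed (simp add: word_value_def)

lemma word_value_mult:
  assumes "fst ` set u \<subseteq> carrier G" "fst ` set v \<subseteq> carrier G"
  shows "word_value G (foldr red_cons u v) = word_value G u \<otimes> word_value G v"
  using assms(1)
proof (induction u)
  case Nil
  then show ?case
    using word_value_closed[OF assms(2)] by (simp add: word_value_def)
next
  case (Cons l u)
  then have "fst ` set (foldr red_cons u v) \<subseteq> carrier G"
    using assms(2) by (intro order_trans[OF letters_foldr]) auto
  then have "word_value G (foldr red_cons (l # u) v)
      = letter_value G l \<otimes> (word_value G u \<otimes> word_value G v)"
    using Cons by (simp add: word_value_red_cons)
  also have "\<dots> = word_value G (l # u) \<otimes> word_value G v"
    using Cons.prems assms(2) letter_value_closed[of l] word_value_closed[of u]
      word_value_closed[of v]
    by (simp add: word_value_def m_assoc)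
  finally show ?case .
qed

lemma word_value_hom:
  assumes "X \<subseteq> carrier G"
  shows "word_value G \<in> hom (free_group X) G"
proof (rule homI)
  have letters: "fst ` set u \<subseteq> carrier G" if "u \<in> carrier (free_group X)" for u
    using order_trans[OF _ assms, of "fst ` set u"] that by (simp add: free_group_def)
  show "word_value G u \<in> carrier G" if "u \<in> carrier (free_group X)" for u
    by (rule word_value_closed[OF letters[OF that]])
  show "word_value G (u \<otimes>\<^bsub>free_group X\<^esub> v) = word_value G u \<otimes> word_value G v"
    if "u \<in> carrier (free_group X)" "v \<in> carrier (free_group X)" for u v
    using word_value_mult[OF letters[OF that(1)] letters[OF that(2)]]
    by (simp add: free_group_def)
qed

lemma word_value_surj:
  assumes "X \<subseteq> carrier G" "generate G X = carrier G"
  shows "word_value G ` carrier (free_group X) = carrier G"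
proof
  show "word_value G ` carrier (free_group X) \<subseteq> carrier G"
    using word_value_hom[OF assms(1)] by (auto simp: hom_def)
  have "g \<in> word_value G ` carrier (free_group X)" if "g \<in> generate G X" for g
    using that
  proof induction
    case one
    show ?case
      by (rule image_eqI[of _ _ "[]"]) (simp_all add: word_value_def free_group_def)
  next
    case (incl x)
    then show ?case
      using assms(1)
      by (intro image_eqI[of _ _ "[(x, True)]"])
        (auto simp: word_value_def letter_value_def free_group_def reduced_Cons)
  next
    case (inv x)
    then show ?case
      using assms(1)
      by (intro image_eqI[of _ _ "[(x, False)]"])
        (auto simp: word_value_def letter_value_def free_group_def reduced_Cons)
  next
    case (eng g h)
    then obtain u v where "u \<in> carrier (free_group X)" "v \<in> carrier (free_group X)"
        "g = word_value G u" "h = word_value G v"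
      by blast
    then show ?case
      using word_value_hom[OF assms(1)] group.is_monoid[OF group_free_group[of X]]
      by (intro image_eqI[of _ _ "u \<otimes>\<^bsub>free_group X\<^esub> v"])
        (auto simp: hom_def monoid.m_closed)
  qed
  then show "carrier G \<subseteq> word_value G ` carrier (free_group X)"
    using assms(2) by blast
qed

end

lemma group_semidirect:
  assumes "group N" "group H" and \<phi>: "\<phi> \<in> hom H (AutoGroup N)"
  shows "group (semidirect N H \<phi>)"
proof -
  interpret N: group N by fact
  interpret H: group H by fact
  have auto: "\<phi> h \<in> auto N" if "h \<in> carrier H" for h
    using \<phi> that by (auto simp: hom_def AutoGroup_def)
  have homN: "\<phi> h \<in> hom N N" and bij: "\<phi> h \<in> Bij (carrier N)" if "h \<in> carrier H" for h
    using auto[OF that] by (auto simp: auto_def)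
  have closed [simp]: "\<phi> h a \<in> carrier N" if "h \<in> carrier H" "a \<in> carrier N" for h a
    using homN[OF that(1)] that(2) by (auto simp: hom_def)
  have mult [simp]: "\<phi> h (a \<otimes>\<^bsub>N\<^esub> b) = \<phi> h a \<otimes>\<^bsub>N\<^esub> \<phi> h b"
    if "h \<in> carrier H" "a \<in> carrier N" "b \<in> carrier N" for h a b
    using homN[OF that(1)] that(2,3) by (auto simp: hom_def)
  have act [simp]: "\<phi> (h \<otimes>\<^bsub>H\<^esub> k) a = \<phi> h (\<phi> k a)"
    if "h \<in> carrier H" "k \<in> carrier H" "a \<in> carrier N" for h k a
    using \<phi> that bij by (auto simp: hom_def AutoGroup_def BijGroup_def compose_def)
  have one [simp]: "\<phi> \<one>\<^bsub>H\<^esub> a = a" if a: "a \<in> carrier N" for a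
  proof -
    have "\<phi> \<one>\<^bsub>H\<^esub> (\<phi> \<one>\<^bsub>H\<^esub> a) = \<phi> \<one>\<^bsub>H\<^esub> a"
      using act[of "\<one>\<^bsub>H\<^esub>" "\<one>\<^bsub>H\<^esub>" a] a by (simp del: act)
    moreover have "inj_on (\<phi> \<one>\<^bsub>H\<^esub>) (carrier N)"
      using bij[of "\<one>\<^bsub>H\<^esub>"] by (auto simp: Bij_def bij_betw_def)
    ultimately show ?thesis
      using a by (auto dest: inj_onD)
  qed
  show ?thesis
  proof (rule groupI)
    fix p assume "p \<in> carrier (semidirect N H \<phi>)"
    then obtain a h where p: "p = (a, h)" "a \<in> carrier N" "h \<in> carrier H"
      by (auto simp: semidirect_def)
    let ?q = "(\<phi> (inv\<^bsub>H\<^esub> h) (inv\<^bsub>N\<^esub> a), inv\<^bsub>H\<^esub> h)"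
    have "\<phi> (inv\<^bsub>H\<^esub> h) (inv\<^bsub>N\<^esub> a) \<otimes>\<^bsub>N\<^esub> \<phi> (inv\<^bsub>H\<^esub> h) a = \<phi> (inv\<^bsub>H\<^esub> h) \<one>\<^bsub>N\<^esub>"
      using p by (simp flip: mult)
    also have "\<dots> = \<one>\<^bsub>N\<^esub>"
      using p homN[of "inv\<^bsub>H\<^esub> h"] by (simp add: hom_one \<open>group N\<close>)
    finally have "?q \<otimes>\<^bsub>semidirect N H \<phi>\<^esub> p = \<one>\<^bsub>semidirect N H \<phi>\<^esub>"
      using p by (simp add: semidirect_def)
    then show "\<exists>q\<in>carrier (semidirect N H \<phi>). q \<otimes>\<^bsub>semidirect N H \<phi>\<^esub> p = \<one>\<^bsub>semidirect N H \<phi>\<^esub>"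
      using p by (intro bexI[of _ ?q]) (simp_all add: semidirect_def)
  qed (auto simp: semidirect_def N.m_assoc H.m_assoc)
qed

end

theory Submission
  imports Defs
begin

text \<open>
  Let \<^term>\<open>X\<close> and \<^term>\<open>Y\<close> be the generating sets of \<^term>\<open>N\<close> and \<^term>\<open>H\<close>. For Folner sets \<^term>\<open>A\<close> of
  \<^term>\<open>H\<close> and \<^term>\<open>B\<close> of \<^term>\<open>N\<close>, consider the products \<open>h b\<close> with \<open>h\<close> in \<^term>\<open>A\<close> and \<open>b\<close> in
  \<^term>\<open>B\<close>, computed in the semidirect product. Left multiplication by a generator \<open>y\<close> of \<^term>\<open>H\<close>
  only affects the factor \<open>h\<close>, so the Folner condition for \<^term>\<open>A\<close> is enough. For a generator
  \<open>x\<close> of \<^term>\<open>N\<close> one writes \<open>x h b = h (h\<^sup>-\<^sup>1 x h) b\<close>, so \<^term>\<open>B\<close> has to be almost invariant under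
  the elements \<open>h\<^sup>-\<^sup>1 x h\<close> of \<^term>\<open>N\<close>.

  Let \<open>C\<close> bound the word lengths of the conjugates of the letters of \<^term>\<open>N\<close> by the letters of
  \<^term>\<open>H\<close>. If \<open>h\<close> is the value of a word of length at most \<open>L\<close>, then \<open>h\<^sup>-\<^sup>1 x h\<close> has length at most
  \<open>C\<^sup>L\<close> (\<open>inv_action_short_elements\<close>). An element of length \<open>k\<close> displaces at most \<open>k\<close> times the
  fraction of a Folner set that a single generator may displace (\<open>folner_set_displacement\<close>).
  Therefore an \<open>n\<close>-Folner set \<^term>\<open>A\<close> given by words of length at most \<open>L\<close> and an
  \<open>n C\<^sup>L\<close>-Folner set \<^term>\<open>B\<close> produce an \<open>n\<close>-Folner set (\<open>semidirect_folner_set\<close>).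

  All of this is effective. The action enters the computation only through the single
  number \<open>C\<close>. The algorithm first runs the one for \<^term>\<open>H\<close>, reads off a bound \<open>L\<close>, runs the one
  for \<^term>\<open>N\<close> on \<open>n C\<^sup>L\<close>, and outputs all concatenations of the words obtained
  (\<open>computable_products\<close>). Two points need care. The output must consist of reduced words even if
  the identity is among both sets of generators, which is achieved by a choice of signs
  (\<open>reduced_right_left\<close>). And the manipulation of lists of words has to be carried out by
  recursive functions on codes, for which a small calculus of recursive terms is developed
  (\<open>recursive_fold\<close> is its main rule).
\<close>

section \<open>A calculus of recursive functions\<close>

text \<open>
  The class \<^term>\<open>total_recursive k\<close> depends on how a function acts on lists of the wrong length,
  so it is not closed under rewriting the function. Passing to agreement on lists of length
  \<^term>\<open>k\<close> removes this obstacle: every construction below may be checked on such lists only, and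
  recursiveness can be proved by following the syntax of the term.
\<close>

definition recursive :: "nat \<Rightarrow> (nat list \<Rightarrow> nat) \<Rightarrow> bool" where
  "recursive k f \<longleftrightarrow> (\<exists>g. total_recursive k g \<and> (\<forall>xs. length xs = k \<longrightarrow> f xs = g xs))"

lemma recursive_cong:
  assumes "recursive k g" "\<And>xs. length xs = k \<Longrightarrow> f xs = g xs"
  shows "recursive k f"
  using assms by (auto simp: recursive_def)

lemma recursive_total: "total_recursive k f \<Longrightarrow> recursive k f"
  by (auto simp: recursive_def)

lemma recursive_nth: "i < k \<Longrightarrow> recursive k (\<lambda>xs. xs ! i)"
  by (intro recursive_total total_recursive.proj)

lemma recursive_comp:
  assumes f: "recursive (length gs) f" and gs: "\<And>g. g \<in> set gs \<Longrightarrow> recursive k g"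
  shows "recursive k (\<lambda>xs. f (map (\<lambda>g. g xs) gs))"
proof -
  obtain f' where f': "total_recursive (length gs) f'"
      "\<And>xs. length xs = length gs \<Longrightarrow> f xs = f' xs"
    using f by (auto simp: recursive_def)
  obtain R where R: "\<And>g. g \<in> set gs \<Longrightarrow> total_recursive k (R g)"
      "\<And>g xs. g \<in> set gs \<Longrightarrow> length xs = k \<Longrightarrow> g xs = R g xs"
    using gs unfolding recursive_def by metis
  have "total_recursive k (\<lambda>xs. f' (map (\<lambda>g. g xs) (map R gs)))"
    using f'(1) R(1) by (intro total_recursive.comp) auto
  then show ?thesis
    by (rule recursive_cong[OF recursive_total])
      (auto simp: f'(2) R(2) comp_def intro!: arg_cong[of _ _ f'] map_cong)
qed

text \<open>
  Reordering, duplicating and forgetting arguments; this is how the parameters of an iteration are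
  passed on to the body of the iteration.
\<close>

lemma recursive_select:
  assumes "recursive k f" "length ps = k" "\<And>p. p \<in> set ps \<Longrightarrow> p < j"
  shows "recursive j (\<lambda>xs. f (map ((!) xs) ps))"
  using recursive_comp[of "map (\<lambda>p xs. xs ! p) ps" f j] assms
  by (auto simp: comp_def intro: recursive_nth)

lemma map_nth_upt: "length xs = d + k \<Longrightarrow> map ((!) xs) [d..<d + k] = drop d xs"
  by (intro nth_equalityI) auto

lemma recursive_drop:
  assumes "recursive k f"
  shows "recursive (d + k) (\<lambda>xs. f (drop d xs))"
  by (rule recursive_cong[OF recursive_select[OF assms, of "[d..<d + k]"]])
    (auto simp: map_nth_upt)

lemma recursive_subst:
  assumes f: "recursive (Suc k) (\<lambda>ys. f (ys ! 0) (drop 1 ys))" and g: "recursive k g"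
  shows "recursive k (\<lambda>xs. f (g xs) xs)"
proof -
  have "recursive k (\<lambda>xs. (\<lambda>ys. f (ys ! 0) (drop 1 ys))
      (map (\<lambda>g. g xs) (g # map (\<lambda>i xs. xs ! i) [0..<k])))"
    using f g by (intro recursive_comp) (auto intro: recursive_nth)
  then show ?thesis
    by (rule recursive_cong) (auto simp: comp_def map_nth)
qed

lemma recursive_const: "recursive k (\<lambda>xs. c)"
proof (induction c)
  case (Suc c)
  show ?case
    using recursive_comp[OF _ , of "[\<lambda>xs. c]" "\<lambda>xs. Suc (xs ! 0)" k]
      recursive_total[OF total_recursive.succ] Suc by simp
qed (intro recursive_total total_recursive.zero)

lemma recursive_unary:
  assumes "recursive 1 (\<lambda>xs. g (xs ! 0))" "recursive k f"
  shows "recursive k (\<lambda>xs. g (f xs))"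
  using recursive_comp[of "[f]" "\<lambda>xs. g (xs ! 0)" k] assms by simp

lemma recursive_Suc: "recursive k f \<Longrightarrow> recursive k (\<lambda>xs. Suc (f xs))"
  using recursive_unary[of Suc] recursive_total[OF total_recursive.succ] by simp

lemma computable_iff_recursive: "computable f \<longleftrightarrow> recursive 1 (\<lambda>xs. f (xs ! 0))"
proof
  show "recursive 1 (\<lambda>xs. f (xs ! 0))" if "computable f"
    using that unfolding computable_def recursive_def
    by (metis (no_types, lifting) One_nat_def length_0_conv length_Suc_conv nth_Cons_0)
next
  assume "recursive 1 (\<lambda>xs. f (xs ! 0))"
  then obtain g where "total_recursive 1 g" "\<And>xs. length xs = 1 \<Longrightarrow> f (xs ! 0) = g xs"
    by (auto simp: recursive_def)
  then show "computable f"
    by (metis One_nat_def computable_def length_Cons list.size(3) nth_Cons_0)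
qed

lemma recursive_computable: "computable g \<Longrightarrow> recursive k f \<Longrightarrow> recursive k (\<lambda>xs. g (f xs))"
  by (simp add: computable_iff_recursive recursive_unary)

text \<open>
  The body \<^term>\<open>s\<close> of a recursion sees the counter and the previous value as two new arguments in
  front of the parameters \<^term>\<open>xs\<close>. In this form the rule applies to any term whose outermost
  symbol is \<^term>\<open>rec_nat\<close>, and loops can be nested.
\<close>

lemma recursive_rec_nat:
  assumes a: "recursive k a" and n: "recursive k n"
    and s: "recursive (Suc (Suc k)) (\<lambda>ys. s (ys ! 0) (ys ! 1) (drop 2 ys))"
  shows "recursive k (\<lambda>xs. rec_nat (a xs) (\<lambda>m r. s m r xs) (n xs))"
proof -
  obtain a' s' where a': "total_recursive k a'" "\<And>xs. length xs = k \<Longrightarrow> a xs = a' xs"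
    and s': "total_recursive (Suc (Suc k)) s'"
      "\<And>xs. length xs = Suc (Suc k) \<Longrightarrow> s (xs ! 0) (xs ! 1) (drop 2 xs) = s' xs"
    using a s unfolding recursive_def by blast
  have s'': "s' (m # r # xs) = s m r xs" if "length xs = k" for m r xs
    using s'(2)[of "m # r # xs"] that by simp
  have "recursive (Suc k) (\<lambda>ys. rec_nat (a (drop 1 ys)) (\<lambda>m r. s m r (drop 1 ys)) (ys ! 0))"
    by (rule recursive_cong[OF recursive_total[OF total_recursive.prim_rec[OF a'(1) s'(1)]]])
      (auto simp: length_Suc_conv a' s'')
  then show ?thesis
    by (rule recursive_subst[where f = "\<lambda>n xs. rec_nat (a xs) (\<lambda>m r. s m r xs) n", OF _ n])
qed

lemma recursive_Least:
  assumes "recursive (Suc k) (\<lambda>ys. f (ys ! 0) (drop 1 ys))"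
    and ex: "\<And>xs. length xs = k \<Longrightarrow> \<exists>m. f m xs = 0"
  shows "recursive k (\<lambda>xs. LEAST m. f m xs = 0)"
proof -
  obtain f' where f': "total_recursive (Suc k) f'"
      "\<And>xs. length xs = Suc k \<Longrightarrow> f (xs ! 0) (drop 1 xs) = f' xs"
    using assms(1) unfolding recursive_def by blast
  have eq: "f' (m # xs) = f m xs" if "length xs = k" for m xs
    using f'(2)[of "m # xs"] that by simp
  show ?thesis
    by (rule recursive_cong[OF recursive_total[OF total_recursive.minimise[OF f'(1)]]])
      (simp_all add: eq ex)
qed

lemma recursive_drop2: "recursive k f \<Longrightarrow> recursive (Suc (Suc k)) (\<lambda>ys. f (drop 2 ys))"
  using recursive_drop[of k f 2] by simp

lemma recursive_if:
  assumes "recursive k c" "recursive k f" "recursive k g"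
  shows "recursive k (\<lambda>xs. if c xs = 0 then f xs else g xs)"
proof (rule recursive_cong)
  show "recursive k (\<lambda>xs. rec_nat (f xs) (\<lambda>m r. g xs) (c xs))"
    using assms by (intro recursive_rec_nat recursive_drop2)
  show "(if c xs = 0 then f xs else g xs) = rec_nat (f xs) (\<lambda>m r. g xs) (c xs)" for xs
    by (cases "c xs") auto
qed

lemma recursive_add:
  assumes "recursive k f" "recursive k g"
  shows "recursive k (\<lambda>xs. f xs + g xs)"
proof (rule recursive_cong)
  show "recursive k (\<lambda>xs. rec_nat (f xs) (\<lambda>m r. Suc r) (g xs))"
    using assms by (intro recursive_rec_nat recursive_Suc recursive_nth) auto
  have "m + n = rec_nat m (\<lambda>_ r. Suc r) n" for m n :: nat
    by (induction n) auto
  then show "f xs + g xs = rec_nat (f xs) (\<lambda>m r. Suc r) (g xs)" for xs .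
qed

lemma recursive_mult:
  assumes "recursive k f" "recursive k g"
  shows "recursive k (\<lambda>xs. f xs * g xs)"
proof (rule recursive_cong)
  show "recursive k (\<lambda>xs. rec_nat 0 (\<lambda>m r. r + f xs) (g xs))"
    using assms
    by (intro recursive_rec_nat recursive_const recursive_add recursive_nth recursive_drop2) auto
  have "m * n = rec_nat 0 (\<lambda>_ r. r + m) n" for m n :: nat
    by (induction n) auto
  then show "f xs * g xs = rec_nat 0 (\<lambda>m r. r + f xs) (g xs)" for xs .
qed

lemma recursive_power:
  assumes "recursive k f" "recursive k g"
  shows "recursive k (\<lambda>xs. f xs ^ g xs)"
proof (rule recursive_cong)
  show "recursive k (\<lambda>xs. rec_nat 1 (\<lambda>m r. r * f xs) (g xs))"
    using assms
    by (intro recursive_rec_nat recursive_const recursive_mult recursive_nth recursive_drop2) auto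
  have "m ^ n = rec_nat 1 (\<lambda>_ r. r * m) n" for m n :: nat
    by (induction n) auto
  then show "f xs ^ g xs = rec_nat 1 (\<lambda>m r. r * f xs) (g xs)" for xs .
qed

lemma recursive_pred:
  assumes "recursive k f"
  shows "recursive k (\<lambda>xs. f xs - 1)"
proof (rule recursive_cong)
  show "recursive k (\<lambda>xs. rec_nat 0 (\<lambda>m r. m) (f xs))"
    using assms by (intro recursive_rec_nat recursive_const recursive_nth) auto
  show "f xs - 1 = rec_nat 0 (\<lambda>m r. m) (f xs)" for xs
    by (cases "f xs") auto
qed

lemma recursive_diff:
  assumes "recursive k f" "recursive k g"
  shows "recursive k (\<lambda>xs. f xs - g xs)"
proof (rule recursive_cong)
  show "recursive k (\<lambda>xs. rec_nat (f xs) (\<lambda>m r. r - 1) (g xs))"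
    using assms by (intro recursive_rec_nat recursive_pred recursive_nth) auto
  have "m - n = rec_nat m (\<lambda>_ r. r - 1) n" for m n :: nat
    by (induction n) auto
  then show "f xs - g xs = rec_nat (f xs) (\<lambda>m r. r - 1) (g xs)" for xs .
qed

lemma recursive_triangle:
  assumes "recursive k f"
  shows "recursive k (\<lambda>xs. triangle (f xs))"
proof (rule recursive_cong)
  show "recursive k (\<lambda>xs. rec_nat 0 (\<lambda>m r. r + Suc m) (f xs))"
    using assms
    by (intro recursive_rec_nat recursive_const recursive_add recursive_Suc recursive_nth) auto
  have "triangle n = rec_nat 0 (\<lambda>m r. r + Suc m) n" for n
    by (induction n) auto
  then show "triangle (f xs) = rec_nat 0 (\<lambda>m r. r + Suc m) (f xs)" for xs .
qed

lemma recursive_prod_encode: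
  assumes "recursive k f" "recursive k g"
  shows "recursive k (\<lambda>xs. prod_encode (f xs, g xs))"
  unfolding prod_encode_def prod.case using assms by (intro recursive_add recursive_triangle)

section \<open>Computing with pairs and lists\<close>

text \<open>
  The pair \<^term>\<open>(a, b)\<close> is coded by \<^term>\<open>triangle (a + b) + a\<close>, where \<^term>\<open>a \<le> a + b\<close>. So
  decoding amounts to finding the largest \<^term>\<open>s\<close> with \<^term>\<open>triangle s \<le> n\<close>, which is an unbounded
  search.
\<close>

definition triangle_root :: "nat \<Rightarrow> nat" where
  "triangle_root n = (LEAST s. Suc n - triangle (Suc s) = 0)"

lemma triangle_mono: "m \<le> n \<Longrightarrow> triangle m \<le> triangle n"
  unfolding triangle_def by (intro div_le_mono mult_le_mono) auto

lemma triangle_root_triangle_add: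
  assumes "a \<le> s"
  shows "triangle_root (triangle s + a) = s"
  unfolding triangle_root_def
proof (rule Least_equality)
  fix t assume t: "Suc (triangle s + a) - triangle (Suc t) = 0"
  show "s \<le> t"
  proof (rule ccontr)
    assume "\<not> s \<le> t"
    then have "triangle (Suc t) \<le> triangle s"
      by (intro triangle_mono) simp
    with t show False
      by simp
  qed
qed (use assms in simp)

lemma prod_decode_triangle_root:
  "prod_decode n = (n - triangle (triangle_root n), triangle_root n - (n - triangle (triangle_root n)))"
proof -
  obtain a b where ab: "n = prod_encode (a, b)"
    by (metis prod_decode_inverse surj_pair)
  have "triangle_root n = a + b"
    using triangle_root_triangle_add[of a "a + b"] by (simp add: ab prod_encode_def)
  then show ?thesis
    by (simp add: ab) (simp add: prod_encode_def)
qed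

lemma recursive_triangle_root:
  assumes "recursive k f"
  shows "recursive k (\<lambda>xs. triangle_root (f xs))"
proof -
  have "\<exists>s. Suc n - triangle (Suc s) = 0" for n
    by (rule exI[of _ n]) simp
  moreover have "recursive (Suc k) (\<lambda>ys. f (drop 1 ys))"
    using recursive_drop[of k f 1] assms by simp
  ultimately show ?thesis
    unfolding triangle_root_def
    by (intro recursive_Least recursive_diff recursive_Suc recursive_triangle recursive_nth) auto
qed

lemma recursive_prod_decode:
  assumes "recursive k f"
  shows "recursive k (\<lambda>xs. fst (prod_decode (f xs)))" "recursive k (\<lambda>xs. snd (prod_decode (f xs)))"
  unfolding prod_decode_triangle_root fst_conv snd_conv using assms
  by (intro recursive_diff recursive_triangle recursive_triangle_root; assumption)+

text \<open>
  Any assignment between finite sets of symbols becomes computable on their codes, because the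
  codes can be compared one by one: the whole table is part of the algorithm.
\<close>

lemma computable_finite_table:
  assumes "finite A" "inj_on c A"
  shows "\<exists>t. computable t \<and> (\<forall>a\<in>A. t (c a) = d a)"
  using assms
proof (induction A)
  case empty
  show ?case
    using recursive_const[of 1 0] by (auto simp: computable_iff_recursive)
next
  case (insert a A)
  then obtain t where t: "computable t" "\<And>a. a \<in> A \<Longrightarrow> t (c a) = d a"
    by auto
  define t' where "t' n = (if (n - c a) + (c a - n) = 0 then d a else t n)" for n
  have "computable t'"
    unfolding computable_iff_recursive t'_def using t(1)
    by (intro recursive_if recursive_add recursive_diff recursive_nth recursive_const
        recursive_computable[OF t(1)]) auto
  moreover have "t' (c b) = d b" if "b \<in> insert a A" for b
    using that insert.prems insert.hyps t(2) by (auto simp: t'_def inj_on_def)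
  ultimately show ?case
    by blast
qed

text \<open>
  The code of a non-empty list is the successor of the code of the pair formed by its head and (the
  code of) its tail. Since \<^term>\<open>0::nat\<close> codes both the empty list and the pair
  \<^term>\<open>(0, 0) :: nat \<times> nat\<close>, truncated subtraction gives the value \<^term>\<open>0::nat\<close> for the tail of
  the empty list.
\<close>

definition tail_code :: "nat \<Rightarrow> nat" where
  "tail_code c = snd (prod_decode (c - 1))"

lemma tail_code_list_encode: "tail_code (list_encode xs) = list_encode (tl xs)"
proof (cases xs)
  case Nil
  have "prod_decode 0 = (0, 0)"
    using prod_encode_inverse[of "(0, 0)"] by (simp add: prod_encode_def)
  with Nil show ?thesis
    by (simp add: tail_code_def)
qed (simp add: tail_code_def)

lemma rec_nat_tail_code:
  "rec_nat (list_encode xs) (\<lambda>_. tail_code) m = list_encode (drop m xs)"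
  by (induction m) (simp_all add: tail_code_list_encode drop_Suc tl_drop)

lemma recursive_tail_code: "recursive k f \<Longrightarrow> recursive k (\<lambda>xs. tail_code (f xs))"
  unfolding tail_code_def by (intro recursive_prod_decode recursive_pred)

lemma le_prod_encode: "a + b \<le> prod_encode (a, b)"
proof -
  have "n \<le> triangle n" for n
    by (induction n) auto
  from this[of "a + b"] show ?thesis
    by (simp add: prod_encode_def)
qed

lemma length_le_list_encode: "length xs \<le> list_encode xs"
proof (induction xs)
  case (Cons x xs)
  then show ?case
    using le_prod_encode[of x "list_encode xs"] by simp
qed simp

lemma mem_le_list_encode: "x \<in> set xs \<Longrightarrow> x \<le> list_encode xs"
proof (induction xs)
  case (Cons y xs)
  then show ?case
    using le_prod_encode[of y "list_encode xs"] by auto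
qed simp

text \<open>
  A list is traversed by a primitive recursion whose \<^term>\<open>m\<close>-th step looks at the head of the
  list with its first \<^term>\<open>m\<close> entries removed and does nothing once this remainder is empty. Since
  the length of a list is bounded by its code \<^term>\<open>c xs\<close>, that many steps suffice.
\<close>

lemma recursive_fold:
  assumes c: "recursive k c" and a: "recursive k a"
    and s: "recursive (Suc (Suc k)) (\<lambda>ys. s (ys ! 0) (ys ! 1) (drop 2 ys))"
  shows "recursive k (\<lambda>xs. fold (\<lambda>x acc. s x acc xs) (list_decode (c xs)) (a xs))"
proof (rule recursive_cong)
  let ?rest = "\<lambda>m xs. rec_nat (c xs) (\<lambda>_. tail_code) m"
  let ?step = "\<lambda>m r xs. if ?rest m xs = 0 then r else s (fst (prod_decode (?rest m xs - 1))) r xs"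
  have rest: "recursive (Suc (Suc k)) (\<lambda>ys. ?rest (ys ! 0) (drop 2 ys))"
    using c by (intro recursive_rec_nat recursive_tail_code recursive_drop2 recursive_nth) auto
  have "recursive (Suc (Suc k))
      (\<lambda>ys. s (fst (prod_decode (?rest (ys ! 0) (drop 2 ys) - 1))) (ys ! 1) (drop 2 ys))"
  proof (rule recursive_cong[OF recursive_subst[where
          f = "\<lambda>x ys. s x (ys ! 1) (drop 2 ys)" and
          g = "\<lambda>ys. fst (prod_decode (?rest (ys ! 0) (drop 2 ys) - 1))"]])
    \<comment> \<open>The arguments are the current entry, the counter, the accumulator and the parameters; the
      step function ignores the counter, which is the argument at position 1.\<close>
    show "recursive (Suc (Suc (Suc k))) (\<lambda>ys. s (ys ! 0) (drop 1 ys ! 1) (drop 2 (drop 1 ys)))"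
    proof (rule recursive_cong[OF recursive_select[OF s, of "0 # 2 # [3..<3 + k]"]])
      fix ys :: "nat list" assume len: "length ys = Suc (Suc (Suc k))"
      have "map ((!) ys) (0 # 2 # [3..<3 + k]) = ys ! 0 # ys ! 2 # drop 3 ys"
        using len unfolding list.map by (subst map_nth_upt) auto
      then show "s (ys ! 0) (drop 1 ys ! 1) (drop 2 (drop 1 ys)) =
          s (map ((!) ys) (0 # 2 # [3..<3 + k]) ! 0) (map ((!) ys) (0 # 2 # [3..<3 + k]) ! 1)
            (drop 2 (map ((!) ys) (0 # 2 # [3..<3 + k])))"
        using len by (simp only: nth_Cons_0 nth_Cons_Suc One_nat_def drop_drop numeral_2_eq_2
            numeral_3_eq_3 drop_Suc_Cons drop_0) simp
    qed auto
  qed (intro recursive_prod_decode recursive_pred rest, simp)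
  then have "recursive (Suc (Suc k)) (\<lambda>ys. ?step (ys ! 0) (ys ! 1) (drop 2 ys))"
    by (intro recursive_if[OF rest] recursive_nth) auto
  then show "recursive k (\<lambda>xs. rec_nat (a xs) (\<lambda>m r. ?step m r xs) (c xs))"
    by (rule recursive_rec_nat[OF a c])
  fix xs :: "nat list"
  let ?l = "list_decode (c xs)"
  have rest_eq: "?rest m xs = list_encode (drop m ?l)" for m
    using rec_nat_tail_code[of ?l m] by simp
  have "rec_nat (a xs) (\<lambda>m r. ?step m r xs) m = fold (\<lambda>x acc. s x acc xs) (take m ?l) (a xs)" for m
  proof (induction m)
    case (Suc m)
    show ?case
    proof (cases "m < length ?l")
      case True
      then have "?rest m xs = Suc (prod_encode (?l ! m, list_encode (drop (Suc m) ?l)))"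
        by (simp add: rest_eq Cons_nth_drop_Suc[symmetric])
      then show ?thesis
        using Suc True by (simp add: take_Suc_conv_app_nth)
    qed (use Suc in \<open>simp add: rest_eq\<close>)
  qed simp
  from this[of "c xs"]
  show "fold (\<lambda>x acc. s x acc xs) ?l (a xs) = rec_nat (a xs) (\<lambda>m r. ?step m r xs) (c xs)"
    using length_le_list_encode[of ?l] by simp
qed

lemma fold_cons_code:
  "fold (\<lambda>x acc. Suc (prod_encode (f x, acc))) xs (list_encode ys) = list_encode (rev (map f xs) @ ys)"
  by (induction xs arbitrary: ys) (simp_all flip: list_encode.simps)

text \<open>
  Prepending the images of the entries one by one to an accumulator reverses their order. This is
  harmless for lists that represent sets; for words the order is restored by a second reversal.
\<close>

lemma recursive_rev_map_append:
  assumes c: "recursive k c" and d: "recursive k d"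
    and f: "recursive (Suc k) (\<lambda>ys. f (ys ! 0) (drop 1 ys))"
  shows "recursive k (\<lambda>xs. list_encode (rev (map (\<lambda>x. f x xs) (list_decode (c xs))) @ list_decode (d xs)))"
proof (rule recursive_cong)
  have "recursive (Suc (Suc k)) (\<lambda>ys. f (ys ! 0) (drop 2 ys))"
  proof (rule recursive_cong[OF recursive_select[OF f, of "0 # [2..<2 + k]"]])
    fix ys :: "nat list" assume len: "length ys = Suc (Suc k)"
    have "map ((!) ys) (0 # [2..<2 + k]) = ys ! 0 # drop 2 ys"
      using len unfolding list.map by (subst map_nth_upt) auto
    then show "f (ys ! 0) (drop 2 ys) =
        f (map ((!) ys) (0 # [2..<2 + k]) ! 0) (drop 1 (map ((!) ys) (0 # [2..<2 + k])))"
      by (simp only: nth_Cons_0 One_nat_def drop_Suc_Cons drop_0)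
  qed auto
  then show "recursive k (\<lambda>xs. fold (\<lambda>x acc. Suc (prod_encode (f x xs, acc))) (list_decode (c xs)) (d xs))"
    using c d by (intro recursive_fold recursive_Suc recursive_prod_encode recursive_nth) auto
  show "list_encode (rev (map (\<lambda>x. f x xs) (list_decode (c xs))) @ list_decode (d xs)) =
      fold (\<lambda>x acc. Suc (prod_encode (f x xs, acc))) (list_decode (c xs)) (d xs)" for xs
    using fold_cons_code[of "\<lambda>x. f x xs" "list_decode (c xs)" "list_decode (d xs)"] by simp
qed

lemma recursive_map_append:
  assumes c: "recursive k c" and d: "recursive k d" and t: "computable t"
  shows "recursive k (\<lambda>xs. list_encode (map t (list_decode (c xs)) @ list_decode (d xs)))"
proof -
  have "recursive k (\<lambda>xs. list_encode (rev (map (\<lambda>x. x) (list_decode (c xs))) @ list_decode 0))"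
    by (intro recursive_rev_map_append c recursive_const recursive_nth) auto
  moreover have "recursive (Suc k) (\<lambda>ys. t (ys ! 0))"
    by (intro recursive_computable[OF t] recursive_nth) simp
  ultimately show ?thesis
    using recursive_rev_map_append[OF _ d, of "\<lambda>xs. list_encode (rev (list_decode (c xs)))" "\<lambda>x _. t x"]
    by (simp add: rev_map)
qed

text \<open>
  Concatenating all words of one finite set with all words of another, after translating each of
  the two alphabets letter by letter, is a double loop over lists of codes.
\<close>

lemma computable_products:
  assumes r: "computable r" and q: "computable q" and s: "computable s" and t: "computable t"
  shows "\<exists>p. computable p \<and> (\<forall>n. set (list_decode (p n)) =
    (\<lambda>(u, v). list_encode (map s (list_decode u) @ map t (list_decode v))) `
      (set (list_decode (r n)) \<times> set (list_decode (q n))))"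
proof -
  let ?h = "\<lambda>u v. list_encode (map s (list_decode u) @ map t (list_decode v))"
  let ?row = "\<lambda>n u acc. list_encode (rev (map (?h u) (list_decode (q n))) @ list_decode acc)"
  define p where "p n = fold (\<lambda>u acc. ?row n u acc) (list_decode (r n)) 0" for n
  have h: "recursive k (\<lambda>xs. ?h (f xs) (g xs))" if "recursive k f" "recursive k g" for k f g
    using recursive_map_append[OF that(1) recursive_map_append[OF that(2) recursive_const[of _ 0] t] s]
    by simp
  have row_param: "recursive (Suc (Suc (Suc (Suc 0)))) (\<lambda>ys. drop (Suc 0) ys ! 0)"
    using recursive_drop[OF recursive_nth[of 0 3], of 1] by (simp add: numeral_3_eq_3)
  have "recursive 1 (\<lambda>xs. p (xs ! 0))"
    unfolding p_def
    by (intro recursive_fold recursive_rev_map_append h recursive_computable[OF r]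
        recursive_computable[OF q] recursive_const recursive_nth
        recursive_drop2[OF recursive_nth]) (use row_param in auto)
  then have "computable p"
    by (simp add: computable_iff_recursive)
  moreover have "set (list_decode (fold (?row n) us a)) =
      case_prod ?h ` (set us \<times> set (list_decode (q n))) \<union> set (list_decode a)" for n us a
    by (induction us arbitrary: a) auto
  ultimately show ?thesis
    by (intro exI[of _ p]) (simp add: p_def)
qed

section \<open>Displacement of Folner sets\<close>

text \<open>
  The ball of radius \<^term>\<open>k\<close> for the word length. Unreduced words are admitted, so that
  products of elements are represented by plain concatenation of words.
\<close>

definition short_elements :: "('a, 'm) monoid_scheme \<Rightarrow> 'a set \<Rightarrow> nat \<Rightarrow> 'a set" where
  "short_elements G X k = {word_value G w | w. fst ` set w \<subseteq> X \<and> length w \<le> k}"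

lemma short_elements_mono: "k \<le> l \<Longrightarrow> short_elements G X k \<subseteq> short_elements G X l"
  by (auto simp: short_elements_def)

lemma word_value_simps [simp]:
  "word_value G [] = \<one>\<^bsub>G\<^esub>"
  "word_value G (l # w) = letter_value G l \<otimes>\<^bsub>G\<^esub> word_value G w"
  by (simp_all add: word_value_def)

context group
begin

lemma word_value_append:
  assumes "fst ` set u \<subseteq> carrier G" "fst ` set v \<subseteq> carrier G"
  shows "word_value G (u @ v) = word_value G u \<otimes> word_value G v"
  using assms(1)
  by (induction u) (auto simp: assms(2) word_value_closed letter_value_closed m_assoc)

lemma short_elements_closed: "X \<subseteq> carrier G \<Longrightarrow> short_elements G X k \<subseteq> carrier G"
  by (fastforce simp: short_elements_def intro!: word_value_closed)

lemma short_elements_one: "\<one> \<in> short_elements G X k"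
  unfolding short_elements_def by (rule CollectI, rule exI[of _ "[]"]) simp

lemma short_elements_mult:
  assumes "X \<subseteq> carrier G" "g \<in> short_elements G X k" "h \<in> short_elements G X l"
  shows "g \<otimes> h \<in> short_elements G X (k + l)"
proof -
  obtain u v where "g = word_value G u" "fst ` set u \<subseteq> X" "length u \<le> k"
      "h = word_value G v" "fst ` set v \<subseteq> X" "length v \<le> l"
    using assms(2,3) by (auto simp: short_elements_def)
  then show ?thesis
    using assms(1) word_value_append[of u v] unfolding short_elements_def
    by (intro CollectI exI[of _ "u @ v"]) auto
qed

lemma mem_short_elements:
  assumes "X \<subseteq> carrier G" "generate G X = carrier G" "g \<in> carrier G"
  shows "\<exists>k. g \<in> short_elements G X k"
proof -
  have "g \<in> word_value G ` carrier (free_group X)"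
    using assms by (simp add: word_value_surj)
  then show ?thesis
    by (fastforce simp: free_group_def short_elements_def)
qed

lemma card_l_coset:
  assumes "g \<in> carrier G" "A \<subseteq> carrier G"
  shows "card (g <# A) = card A"
proof -
  have "inj_on (\<lambda>a. g \<otimes> a) A"
    using inj_on_subset[OF inj_on_cmult[OF assms(1)] assms(2)] .
  moreover have "g <# A = (\<lambda>a. g \<otimes> a) ` A"
    by (auto simp: l_coset_def)
  ultimately show ?thesis
    by (simp add: card_image)
qed

lemma l_coset_Diff:
  assumes "g \<in> carrier G" "A \<subseteq> carrier G" "B \<subseteq> carrier G"
  shows "g <# (A - B) = (g <# A) - (g <# B)"
proof -
  have "g <# C = (\<lambda>a. g \<otimes> a) ` C" for C
    by (auto simp: l_coset_def)
  moreover have "A - B \<subseteq> carrier G"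
    using assms(2) by blast
  ultimately show ?thesis
    using inj_on_image_set_diff[OF inj_on_cmult[OF assms(1)] _ assms(3)] by simp
qed

lemma finite_l_coset: "finite A \<Longrightarrow> finite (g <# A)"
  by (simp add: l_coset_def)

text \<open>
  Translation by \<^term>\<open>g\<close> turns \<^term>\<open>A - (inv g <# A)\<close> into \<^term>\<open>(g <# A) - A\<close>, and two finite sets of equal
  size have differences of equal size.
\<close>

lemma card_Diff_l_coset_inv:
  assumes g: "g \<in> carrier G" and A: "finite A" "A \<subseteq> carrier G"
  shows "card (A - (inv g <# A)) = card (A - (g <# A))"
proof -
  have "card (A - (inv g <# A)) = card (g <# (A - (inv g <# A)))"
    using assms by (intro card_l_coset[symmetric]) auto
  also have "g <# (A - (inv g <# A)) = (g <# A) - A"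
    using assms by (simp add: l_coset_Diff l_coset_subset_G lcos_m_assoc lcos_mult_one)
  also have "card ((g <# A) - A) = card (A - (g <# A))"
    using card_le_sym_Diff[of A "g <# A"] card_le_sym_Diff[of "g <# A" A] assms
    by (simp add: card_l_coset finite_l_coset)
  finally show ?thesis .
qed

text \<open>
  Triangle inequality for the displacement of \<^term>\<open>A\<close>: an element of \<^term>\<open>A\<close> outside
  \<^term>\<open>g \<otimes> h <# A\<close> is outside \<^term>\<open>g <# A\<close>, or it lies in \<^term>\<open>g <# (A - (h <# A))\<close>.
\<close>

lemma card_Diff_l_coset_mult:
  assumes g: "g \<in> carrier G" and h: "h \<in> carrier G" and A: "finite A" "A \<subseteq> carrier G"
  shows "card (A - (g \<otimes> h <# A)) \<le> card (A - (g <# A)) + card (A - (h <# A))"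
proof -
  have "A - (g \<otimes> h <# A) \<subseteq> (A - (g <# A)) \<union> ((g <# A) - (g <# (h <# A)))"
    using g h A(2) by (auto simp: lcos_m_assoc)
  then have "card (A - (g \<otimes> h <# A)) \<le> card ((A - (g <# A)) \<union> ((g <# A) - (g <# (h <# A))))"
    using A by (intro card_mono) (auto simp: finite_l_coset)
  also have "\<dots> \<le> card (A - (g <# A)) + card ((g <# A) - (g <# (h <# A)))"
    by (rule card_Un_le)
  also have "(g <# A) - (g <# (h <# A)) = g <# (A - (h <# A))"
    using assms by (simp add: l_coset_Diff l_coset_subset_G)
  also have "card (g <# (A - (h <# A))) = card (A - (h <# A))"
    using assms by (intro card_l_coset) auto
  finally show ?thesis
    by simp
qed

text \<open>
  The displacement of a Folner set grows at most linearly with the word length of the translating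
  element, by subadditivity. Thus a Folner set for a large parameter \<^term>\<open>m\<close> is almost invariant
  under a whole ball.
\<close>

lemma folner_set_displacement:
  assumes F: "folner_set G X m F" and X: "X \<subseteq> carrier G"
    and g: "g \<in> short_elements G X k"
  shows "real (card (F - (g <# F))) \<le> real k * real (card F) / real m"
proof -
  have fin: "finite F" "F \<subseteq> carrier G" "F \<noteq> {}"
    using F by (auto simp: folner_set_def)
  have letter: "real (card (F - (letter_value G l <# F))) \<le> real (card F) / real m"
    if "fst l \<in> X" for l
  proof -
    have x: "fst l \<in> carrier G"
      using that X by blast
    have "real (card (F - (fst l <# F))) / real (card F) \<le> inverse (real m)"
      using F that by (auto simp: folner_set_def)
    then have "real (card (F - (fst l <# F))) \<le> real (card F) / real m"
      using fin by (simp add: divide_le_eq card_gt_0_iff field_simps)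
    then show ?thesis
      using card_Diff_l_coset_inv[OF x fin(1,2)] by (simp add: letter_value_def)
  qed
  have word: "real (card (F - (word_value G w <# F))) \<le> real (length w) * real (card F) / real m"
    if "fst ` set w \<subseteq> X" for w
    using that
  proof (induction w)
    case Nil
    then show ?case
      using fin by (simp add: lcos_mult_one)
  next
    case (Cons l w)
    have "letter_value G l \<in> carrier G" "word_value G w \<in> carrier G"
      using Cons.prems X by (auto intro!: letter_value_closed word_value_closed)
    from card_Diff_l_coset_mult[OF this fin(1,2)]
    have "real (card (F - (word_value G (l # w) <# F)))
        \<le> real (card (F - (letter_value G l <# F))) + real (card (F - (word_value G w <# F)))"
      by simp
    also have "\<dots> \<le> real (card F) / real m + real (length w) * real (card F) / real m"
      using Cons letter[of l] by (intro add_mono) auto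
    also have "\<dots> = real (length (l # w)) * real (card F) / real m"
      by (simp add: distrib_right add_divide_distrib)
    finally show ?case .
  qed
  obtain w where w: "g = word_value G w" "fst ` set w \<subseteq> X" "length w \<le> k"
    using g by (auto simp: short_elements_def)
  have "real (length w) * real (card F) / real m \<le> real k * real (card F) / real m"
    using w(3) by (intro divide_right_mono mult_right_mono) auto
  with word[OF w(2)] w(1) show ?thesis
    by simp
qed

end

lemma (in group_hom) word_value_map:
  assumes "\<And>l. l \<in> set w \<Longrightarrow> fst l \<in> carrier G"
    and "\<And>l. l \<in> set w \<Longrightarrow> letter_value H (j l) = h (letter_value G l)"
  shows "word_value H (map j w) = h (word_value G w)"
  using assms
proof (induction w)
  case (Cons l w)
  then have "letter_value G l \<in> carrier G" "word_value G w \<in> carrier G"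
    by (fastforce intro!: G.letter_value_closed G.word_value_closed)+
  with Cons show ?case
    by simp
qed simp

lemma (in group_hom) short_elements_hom:
  assumes X: "X \<subseteq> carrier G" and Y: "Y \<subseteq> carrier H"
    and C: "\<And>l. fst l \<in> X \<Longrightarrow> h (letter_value G l) \<in> short_elements H Y C"
    and g: "g \<in> short_elements G X k"
  shows "h g \<in> short_elements H Y (k * C)"
proof -
  have word: "h (word_value G w) \<in> short_elements H Y (length w * C)"
    if "fst ` set w \<subseteq> X" for w
    using that
  proof (induction w)
    case (Cons l w)
    then have "letter_value G l \<in> carrier G" "word_value G w \<in> carrier G"
      using X by (auto intro!: G.letter_value_closed G.word_value_closed)
    then show ?case
      using H.short_elements_mult[OF Y C Cons.IH, of l] Cons.prems by simp
  qed (simp add: H.short_elements_one)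
  obtain w where w: "g = word_value G w" "fst ` set w \<subseteq> X" "length w \<le> k"
    using g by (auto simp: short_elements_def)
  then show ?thesis
    using word[OF w(2)] short_elements_mono[of "length w * C" "k * C" H Y]
      mult_right_mono[OF w(3), of C] by auto
qed

section \<open>Folner sets in semidirect products\<close>

locale automorphism_action = N: group N + H: group H
  for N :: "('a, 'm) monoid_scheme" (structure) and H :: "('b, 'k) monoid_scheme" (structure)
    and \<phi> :: "'b \<Rightarrow> 'a \<Rightarrow> 'a" +
  assumes action_hom: "\<phi> \<in> hom H (AutoGroup N)"
begin

abbreviation G :: "('a \<times> 'b) monoid" where
  "G \<equiv> semidirect N H \<phi>"

sublocale G: group G
  by (rule group_semidirect[OF N.group_axioms H.group_axioms action_hom])

lemma action_auto: "h \<in> carrier H \<Longrightarrow> \<phi> h \<in> auto N"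
  using action_hom by (auto simp: hom_def AutoGroup_def)

lemma action_group_hom: "h \<in> carrier H \<Longrightarrow> group_hom N N (\<phi> h)"
  using action_auto[of h] by (simp add: auto_def group_hom_def group_hom_axioms_def)

lemma action_closed [simp]: "h \<in> carrier H \<Longrightarrow> a \<in> carrier N \<Longrightarrow> \<phi> h a \<in> carrier N"
  by (rule group_hom.hom_closed[OF action_group_hom])

lemma action_inj: "h \<in> carrier H \<Longrightarrow> inj_on (\<phi> h) (carrier N)"
  using action_auto[of h] by (auto simp: auto_def Bij_def bij_betw_def)

lemma action_mult [simp]:
  "h \<in> carrier H \<Longrightarrow> a \<in> carrier N \<Longrightarrow> b \<in> carrier N \<Longrightarrow> \<phi> h (a \<otimes>\<^bsub>N\<^esub> b) = \<phi> h a \<otimes>\<^bsub>N\<^esub> \<phi> h b"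
  by (rule group_hom.hom_mult[OF action_group_hom])

lemma action_one [simp]: "h \<in> carrier H \<Longrightarrow> \<phi> h \<one>\<^bsub>N\<^esub> = \<one>\<^bsub>N\<^esub>"
  by (rule group_hom.hom_one[OF action_group_hom])

text \<open>
  Multiplication in \<^term>\<open>AutoGroup N\<close> is composition restricted to the carrier, so this holds for
  elements of \<^term>\<open>N\<close> only.
\<close>

lemma action_action:
  "h \<in> carrier H \<Longrightarrow> k \<in> carrier H \<Longrightarrow> a \<in> carrier N \<Longrightarrow> \<phi> (h \<otimes>\<^bsub>H\<^esub> k) a = \<phi> h (\<phi> k a)"
  using action_hom action_auto
  by (auto simp: hom_def AutoGroup_def BijGroup_def auto_def compose_def)

lemma one_action [simp]: "a \<in> carrier N \<Longrightarrow> \<phi> \<one>\<^bsub>H\<^esub> a = a"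
  using action_action[of "\<one>\<^bsub>H\<^esub>" "\<one>\<^bsub>H\<^esub>" a] inj_onD[OF action_inj[of "\<one>\<^bsub>H\<^esub>"], of "\<phi> \<one>\<^bsub>H\<^esub> a" a]
  by simp

lemma action_inv_action [simp]:
  assumes "h \<in> carrier H" "a \<in> carrier N"
  shows "\<phi> h (\<phi> (inv\<^bsub>H\<^esub> h) a) = a"
  using assms action_action[of h "inv\<^bsub>H\<^esub> h" a] by simp

lemma semidirect_simps [simp]:
  "(a, h) \<otimes>\<^bsub>G\<^esub> (b, k) = (a \<otimes>\<^bsub>N\<^esub> \<phi> h b, h \<otimes>\<^bsub>H\<^esub> k)"
  "\<one>\<^bsub>G\<^esub> = (\<one>\<^bsub>N\<^esub>, \<one>\<^bsub>H\<^esub>)"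
  "carrier G = carrier N \<times> carrier H"
  by (simp_all add: semidirect_def)

sublocale left: group_hom N G "\<lambda>a. (a, \<one>\<^bsub>H\<^esub>)"
  by unfold_locales (auto simp: hom_def)

sublocale right: group_hom H G "\<lambda>h. (\<one>\<^bsub>N\<^esub>, h)"
  by unfold_locales (auto simp: hom_def)

definition gens :: "'a set \<Rightarrow> 'b set \<Rightarrow> ('a \<times> 'b) set" where
  "gens X Y = (\<lambda>a. (a, \<one>\<^bsub>H\<^esub>)) ` X \<union> (\<lambda>h. (\<one>\<^bsub>N\<^esub>, h)) ` Y"

lemma finite_generating_set_gens:
  assumes X: "finite_generating_set N X" and Y: "finite_generating_set H Y"
  shows "finite_generating_set G (gens X Y)"
proof -
  have sub: "gens X Y \<subseteq> carrier G" and fin: "finite (gens X Y)"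
    using X Y by (auto simp: finite_generating_set_def gens_def)
  have "(a, h) \<in> generate G (gens X Y)" if "a \<in> carrier N" "h \<in> carrier H" for a h
  proof -
    have "generate G ((\<lambda>a. (a, \<one>\<^bsub>H\<^esub>)) ` X) = (\<lambda>a. (a, \<one>\<^bsub>H\<^esub>)) ` generate N X"
      using X by (intro left.generate_img) (simp add: finite_generating_set_def)
    moreover have "generate G ((\<lambda>h. (\<one>\<^bsub>N\<^esub>, h)) ` Y) = (\<lambda>h. (\<one>\<^bsub>N\<^esub>, h)) ` generate H Y"
      using Y by (intro right.generate_img) (simp add: finite_generating_set_def)
    ultimately have "(a, \<one>\<^bsub>H\<^esub>) \<in> generate G ((\<lambda>a. (a, \<one>\<^bsub>H\<^esub>)) ` X)"
        "(\<one>\<^bsub>N\<^esub>, h) \<in> generate G ((\<lambda>h. (\<one>\<^bsub>N\<^esub>, h)) ` Y)"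
      using that X Y by (auto simp: finite_generating_set_def)
    then have "(a, \<one>\<^bsub>H\<^esub>) \<otimes>\<^bsub>G\<^esub> (\<one>\<^bsub>N\<^esub>, h) \<in> generate G (gens X Y)"
      using G.mono_generate[of "(\<lambda>a. (a, \<one>\<^bsub>H\<^esub>)) ` X" "gens X Y"]
        G.mono_generate[of "(\<lambda>h. (\<one>\<^bsub>N\<^esub>, h)) ` Y" "gens X Y"]
      by (intro generate.eng) (auto simp: gens_def)
    with that show ?thesis
      by simp
  qed
  with G.generate_incl[OF sub] sub fin show ?thesis
    by (auto simp: finite_generating_set_def)
qed

text \<open>
  There are only finitely many pairs of letters, so the images of the generators of \<^term>\<open>N\<close> and
  of their inverses under the action of single letters of \<^term>\<open>H\<close> have bounded length. A bound of
  this kind is a constant, so the algorithm may contain it without a way of computing it.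
\<close>

lemma ex_distortion_constant:
  assumes X: "finite_generating_set N X" and Y: "finite_generating_set H Y"
  shows "\<exists>C\<ge>1. \<forall>l l'. fst l \<in> X \<longrightarrow> fst l' \<in> Y \<longrightarrow>
    \<phi> (inv\<^bsub>H\<^esub> (letter_value H l')) (letter_value N l) \<in> short_elements N X C"
proof -
  let ?S = "(X \<times> (UNIV :: bool set)) \<times> (Y \<times> (UNIV :: bool set))"
  let ?g = "\<lambda>(l, l'). \<phi> (inv\<^bsub>H\<^esub> (letter_value H l')) (letter_value N l)"
  have sub: "X \<subseteq> carrier N" "Y \<subseteq> carrier H" and fin: "finite ?S"
    using X Y by (simp_all add: finite_generating_set_def)
  have "\<exists>k. ?g p \<in> short_elements N X k" if "p \<in> ?S" for p
    using that sub X
    by (intro N.mem_short_elements)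
      (auto simp: finite_generating_set_def intro!: action_closed N.letter_value_closed
        H.inv_closed H.letter_value_closed)
  then obtain k where k: "\<And>p. p \<in> ?S \<Longrightarrow> ?g p \<in> short_elements N X (k p)"
    by metis
  have "?g p \<in> short_elements N X (Suc (\<Sum>p\<in>?S. k p))" if "p \<in> ?S" for p
    using k[OF that] short_elements_mono[of "k p" "Suc (\<Sum>p\<in>?S. k p)" N X]
      member_le_sum[OF that _ fin, of k] by auto
  then show ?thesis
    by (intro exI[of _ "Suc (\<Sum>p\<in>?S. k p)"]) force
qed

text \<open>
  The action of a word is the composition of the actions of its letters, each of which stretches
  lengths at most by the factor \<^term>\<open>C\<close>.
\<close>

lemma inv_action_short_elements:
  assumes X: "X \<subseteq> carrier N" and Y: "Y \<subseteq> carrier H"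
    and C: "\<And>l l'. fst l \<in> X \<Longrightarrow> fst l' \<in> Y \<Longrightarrow>
      \<phi> (inv\<^bsub>H\<^esub> (letter_value H l')) (letter_value N l) \<in> short_elements N X C"
    and u: "fst ` set u \<subseteq> Y" and g: "g \<in> short_elements N X k"
  shows "\<phi> (inv\<^bsub>H\<^esub> (word_value H u)) g \<in> short_elements N X (k * C ^ length u)"
  using u g
proof (induction u arbitrary: g k)
  case Nil
  then show ?case
    using N.short_elements_closed[OF X, of k] by auto
next
  case (Cons l u)
  have mem: "letter_value H l \<in> carrier H" "word_value H u \<in> carrier H" "g \<in> carrier N"
    using Cons.prems Y N.short_elements_closed[OF X, of k]
    by (auto intro!: H.letter_value_closed H.word_value_closed)
  then interpret l: group_hom N N "\<phi> (inv\<^bsub>H\<^esub> (letter_value H l))"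
    by (intro action_group_hom) simp
  have "\<phi> (inv\<^bsub>H\<^esub> (letter_value H l)) g \<in> short_elements N X (k * C)"
    using Cons.prems by (intro l.short_elements_hom[OF X X C]) auto
  from Cons.IH[OF _ this] Cons.prems
  have "\<phi> (inv\<^bsub>H\<^esub> (word_value H u)) (\<phi> (inv\<^bsub>H\<^esub> (letter_value H l)) g)
      \<in> short_elements N X (k * C ^ length (l # u))"
    by (simp add: mult.assoc)
  then show ?case
    using mem by (simp add: H.inv_mult_group action_action)
qed

text \<open>
  The set in the conclusion is the product of \<^term>\<open>A\<close> and \<^term>\<open>B\<close> with the factor from \<^term>\<open>H\<close> on the
  left, since the product of \<^term>\<open>(\<one>\<^bsub>N\<^esub>, h)\<close> and \<^term>\<open>(b, \<one>\<^bsub>H\<^esub>)\<close> is \<^term>\<open>(\<phi> h b, h)\<close>. Hence a generator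
  from \<^term>\<open>H\<close> moves only the factor from \<^term>\<open>A\<close>, while a generator \<^term>\<open>x\<close> of \<^term>\<open>N\<close> can be
  carried past \<^term>\<open>h\<close> at the price of becoming \<^term>\<open>\<phi> (inv\<^bsub>H\<^esub> h) x\<close>: on the slice over
  \<^term>\<open>h\<close> it acts as this element does on \<^term>\<open>B\<close>. The elements that arise are short by hypothesis,
  and \<^term>\<open>B\<close> is invariant enough to tolerate all of them.
\<close>

lemma semidirect_folner_set:
  assumes A: "folner_set H Y n A" and B: "folner_set N X m B"
    and X: "X \<subseteq> carrier N" and Y: "Y \<subseteq> carrier H" and m: "m = n * k" "k \<ge> 1"
    and short: "\<And>x h. x \<in> X \<Longrightarrow> h \<in> A \<Longrightarrow> \<phi> (inv\<^bsub>H\<^esub> h) x \<in> short_elements N X k"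
  shows "folner_set G (gens X Y) n ((\<lambda>(h, b). (\<phi> h b, h)) ` (A \<times> B))"
proof -
  let ?f = "\<lambda>(h, b). (\<phi> h b, h)"
  let ?F = "?f ` (A \<times> B)"
  have A': "finite A" "A \<noteq> {}" "A \<subseteq> carrier H" and B': "finite B" "B \<noteq> {}" "B \<subseteq> carrier N"
    using A B by (auto simp: folner_set_def)
  have cl: "h \<in> carrier H" "b \<in> carrier N" if "h \<in> A" "b \<in> B" for h b
    using that A' B' by auto
  have "inj_on ?f (A \<times> B)"
    using A' B' by (auto simp: inj_on_def dest!: inj_onD[OF action_inj])
  then have card: "card ?F = card A * card B"
    by (simp add: card_image card_cartesian_product)
  have pos: "0 < card A" "0 < card B"
    using A' B' by (auto simp: card_gt_0_iff)
  have bound: "real (card (?F - (g <#\<^bsub>G\<^esub> ?F))) / real (card ?F) \<le> inverse (real n)"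
    if "?F - (g <#\<^bsub>G\<^esub> ?F) \<subseteq> ?f ` D" "finite D" "real (card D) \<le> real (card A) * real (card B) / real n"
    for g D
  proof -
    have "card (?F - (g <#\<^bsub>G\<^esub> ?F)) \<le> card (?f ` D)"
      using that by (intro card_mono) auto
    also have "\<dots> \<le> card D"
      using that by (intro card_image_le)
    finally have "real (card (?F - (g <#\<^bsub>G\<^esub> ?F))) \<le> real (card A) * real (card B) / real n"
      using that(3) by linarith
    then show ?thesis
      using pos by (simp add: card divide_le_eq field_simps)
  qed
  have right: "real (card (?F - ((\<one>\<^bsub>N\<^esub>, y) <#\<^bsub>G\<^esub> ?F))) / real (card ?F) \<le> inverse (real n)"
    if y: "y \<in> Y" for y
  proof (rule bound)
    have yc: "y \<in> carrier H"
      using y Y by blast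
    show "?F - ((\<one>\<^bsub>N\<^esub>, y) <#\<^bsub>G\<^esub> ?F) \<subseteq> ?f ` ((A - (y <#\<^bsub>H\<^esub> A)) \<times> B)"
    proof
      fix p assume p: "p \<in> ?F - ((\<one>\<^bsub>N\<^esub>, y) <#\<^bsub>G\<^esub> ?F)"
      then obtain h b where hb: "p = (\<phi> h b, h)" "h \<in> A" "b \<in> B"
        by auto
      have "h \<notin> y <#\<^bsub>H\<^esub> A"
      proof
        assume "h \<in> y <#\<^bsub>H\<^esub> A"
        then obtain h' where h': "h' \<in> A" "h = y \<otimes>\<^bsub>H\<^esub> h'"
          by (auto simp: l_coset_def)
        then have "p = (\<one>\<^bsub>N\<^esub>, y) \<otimes>\<^bsub>G\<^esub> ?f (h', b)"
          using hb yc cl by (simp add: action_action)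
        then have "p \<in> (\<one>\<^bsub>N\<^esub>, y) <#\<^bsub>G\<^esub> ?F"
          using h' hb by (auto simp: l_coset_def simp del: semidirect_simps)
        with p show False
          by blast
      qed
      with hb show "p \<in> ?f ` ((A - (y <#\<^bsub>H\<^esub> A)) \<times> B)"
        by auto
    qed
    have "real (card (A - (y <#\<^bsub>H\<^esub> A))) \<le> real (card A) / real n"
      using A y pos by (auto simp: folner_set_def divide_le_eq field_simps)
    from mult_right_mono[OF this, of "real (card B)"]
    show "real (card ((A - (y <#\<^bsub>H\<^esub> A)) \<times> B)) \<le> real (card A) * real (card B) / real n"
      by (simp add: card_cartesian_product)
  qed (use A' B' in auto)
  have left: "real (card (?F - ((x, \<one>\<^bsub>H\<^esub>) <#\<^bsub>G\<^esub> ?F))) / real (card ?F) \<le> inverse (real n)"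
    if x: "x \<in> X" for x
  proof (rule bound)
    let ?D = "SIGMA h:A. B - (\<phi> (inv\<^bsub>H\<^esub> h) x <#\<^bsub>N\<^esub> B)"
    have xc: "x \<in> carrier N"
      using x X by blast
    show "?F - ((x, \<one>\<^bsub>H\<^esub>) <#\<^bsub>G\<^esub> ?F) \<subseteq> ?f ` ?D"
    proof
      fix p assume p: "p \<in> ?F - ((x, \<one>\<^bsub>H\<^esub>) <#\<^bsub>G\<^esub> ?F)"
      then obtain h b where hb: "p = (\<phi> h b, h)" "h \<in> A" "b \<in> B"
        by auto
      have "b \<notin> \<phi> (inv\<^bsub>H\<^esub> h) x <#\<^bsub>N\<^esub> B"
      proof
        assume "b \<in> \<phi> (inv\<^bsub>H\<^esub> h) x <#\<^bsub>N\<^esub> B"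
        then obtain b' where b': "b' \<in> B" "b = \<phi> (inv\<^bsub>H\<^esub> h) x \<otimes>\<^bsub>N\<^esub> b'"
          by (auto simp: l_coset_def)
        then have "p = (x, \<one>\<^bsub>H\<^esub>) \<otimes>\<^bsub>G\<^esub> ?f (h, b')"
          using hb xc cl by simp
        then have "p \<in> (x, \<one>\<^bsub>H\<^esub>) <#\<^bsub>G\<^esub> ?F"
          using b' hb by (auto simp: l_coset_def simp del: semidirect_simps)
        with p show False
          by blast
      qed
      with hb show "p \<in> ?f ` ?D"
        by auto
    qed
    have "real (card (B - (\<phi> (inv\<^bsub>H\<^esub> h) x <#\<^bsub>N\<^esub> B))) \<le> real (card B) / real n" if "h \<in> A" for h
      using N.folner_set_displacement[OF B X short[OF x that]] m by simp
    then have "real (\<Sum>h\<in>A. card (B - (\<phi> (inv\<^bsub>H\<^esub> h) x <#\<^bsub>N\<^esub> B))) \<le> (\<Sum>h\<in>A. real (card B) / real n)"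
      by (simp only: of_nat_sum) (rule sum_mono)
    then show "real (card ?D) \<le> real (card A) * real (card B) / real n"
      using A' B' by (subst card_SigmaI) auto
  qed (use A' B' in auto)
  show ?thesis
    unfolding folner_set_def
  proof (intro conjI ballI)
    show "real (card (?F - (g <#\<^bsub>G\<^esub> ?F))) / real (card ?F) \<le> inverse (real n)" if "g \<in> gens X Y" for g
      using that left right by (auto simp: gens_def)
  qed (use A' B' cl in auto)
qed

end

section \<open>Words for the product sets\<close>

lemma length_word_code: "length w \<le> word_code e w"
  using length_le_list_encode[of "map (\<lambda>(x, b). prod_encode (e x, of_bool b)) w"]
  by (simp add: word_code_def)

text \<open>
  A change of alphabet is computable whatever numberings of the two alphabets are used, since only
  finitely many letters have to be translated.
\<close>

lemma ex_letter_translation: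
  fixes j :: "'a \<times> bool \<Rightarrow> 'c \<times> bool"
  assumes "finite X" "inj_on e X"
  shows "\<exists>t. computable t \<and> (\<forall>w. fst ` set w \<subseteq> X \<longrightarrow>
    map t (list_decode (word_code e w)) = list_decode (word_code e' (map j w)))"
proof -
  let ?c = "\<lambda>(x, b). prod_encode (e x, of_bool b)"
  let ?c' = "\<lambda>(x, b). prod_encode (e' x, of_bool b)"
  have "finite (X \<times> (UNIV :: bool set))" "inj_on ?c (X \<times> UNIV)"
    using assms by (auto simp: inj_on_def)
  from computable_finite_table[OF this, of "\<lambda>l. ?c' (j l)"] obtain t where
    t: "computable t" "\<And>l. fst l \<in> X \<Longrightarrow> t (?c l) = ?c' (j l)"
    by force
  then show ?thesis
    by (intro exI[of _ t]) (auto simp: word_code_def)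
qed

context automorphism_action
begin

text \<open>
  The two sets of generators are disjoint in the semidirect product, except that the identity may
  belong to both. Cancellation between a word over one alphabet and a word over the other can then
  only involve the letters of the identity. Since replacing such a letter by its inverse does not
  change the value of a word, all of them are given the positive sign, which rules cancellation
  out.
\<close>

definition left_letter :: "'a \<times> bool \<Rightarrow> ('a \<times> 'b) \<times> bool" where
  "left_letter l = ((fst l, \<one>\<^bsub>H\<^esub>), snd l \<or> fst l = \<one>\<^bsub>N\<^esub>)"

definition right_letter :: "'b \<times> bool \<Rightarrow> ('a \<times> 'b) \<times> bool" where
  "right_letter l = ((\<one>\<^bsub>N\<^esub>, fst l), snd l \<or> fst l = \<one>\<^bsub>H\<^esub>)"

lemma letter_value_left_letter:
  "fst l \<in> carrier N \<Longrightarrow> letter_value G (left_letter l) = (letter_value N l, \<one>\<^bsub>H\<^esub>)"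
  by (auto simp: letter_value_def left_letter_def simp flip: left.hom_inv)

lemma letter_value_right_letter:
  "fst l \<in> carrier H \<Longrightarrow> letter_value G (right_letter l) = (\<one>\<^bsub>N\<^esub>, letter_value H l)"
  by (auto simp: letter_value_def right_letter_def simp flip: right.hom_inv)

text \<open>
  Inside a reduced word, neighbouring letters of the identity have the same sign already, so
  making all signs positive preserves reducedness; at the junction of the two words, a cancelling
  pair would consist of letters of the identity with opposite signs.
\<close>

lemma reduced_right_left:
  assumes "reduced u" "reduced v"
  shows "reduced (map right_letter u @ map left_letter v)"
proof -
  have "reduced (map right_letter u)"
    using assms(1) unfolding reduced_def successively_map
    by (rule successively_mono) (auto simp: right_letter_def flip_def prod_eq_iff)
  moreover have "reduced (map left_letter v)"
    using assms(2) unfolding reduced_def successively_map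
    by (rule successively_mono) (auto simp: left_letter_def flip_def prod_eq_iff)
  moreover have "left_letter l' \<noteq> flip (right_letter l)" for l l'
    by (auto simp: left_letter_def right_letter_def flip_def)
  ultimately show ?thesis
    by (cases u rule: rev_cases; cases v) (auto simp: reduced_def successively_append_iff)
qed

lemma word_value_right_left:
  assumes "fst ` set u \<subseteq> carrier H" "fst ` set v \<subseteq> carrier N"
  shows "word_value G (map right_letter u @ map left_letter v) =
    (\<phi> (word_value H u) (word_value N v), word_value H u)"
proof -
  have u: "word_value G (map right_letter u) = (\<one>\<^bsub>N\<^esub>, word_value H u)"
    using assms(1) by (intro right.word_value_map letter_value_right_letter) auto
  have v: "word_value G (map left_letter v) = (word_value N v, \<one>\<^bsub>H\<^esub>)"
    using assms(2) by (intro left.word_value_map letter_value_left_letter) auto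
  have "fst ` set (map right_letter u) \<subseteq> carrier G" "fst ` set (map left_letter v) \<subseteq> carrier G"
    using assms by (auto simp: right_letter_def left_letter_def)
  then show ?thesis
    using H.word_value_closed[OF assms(1)] N.word_value_closed[OF assms(2)]
    by (simp add: G.word_value_append u v)
qed

text \<open>
  What has to be computed is only a parameter \<^term>\<open>m n\<close> for which the Folner set of \<^term>\<open>N\<close> is
  invariant enough. It has to exceed \<^term>\<open>n\<close> by the factor \<^term>\<open>C ^ L\<close>, where \<^term>\<open>L\<close> bounds the
  lengths of the words produced for \<^term>\<open>H\<close>. The code of the list of these words is itself such a
  bound, because codes of lists dominate lengths and entries.
\<close>

lemma computable_folner_sets_semidirect:
  assumes X: "finite_generating_set N X" and Y: "finite_generating_set H Y"
    and N: "computable_folner_sets_wrt N X" and H: "computable_folner_sets_wrt H Y"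
  shows "computable_folner_sets_wrt G (gens X Y)"
proof -
  have Xc: "X \<subseteq> carrier N" "finite X" and Yc: "Y \<subseteq> carrier H" "finite Y"
    using X Y by (auto simp: finite_generating_set_def)
  obtain A d r where A: "\<And>n. finite (A n)" "\<And>n. A n \<subseteq> carrier (free_group Y)"
      "\<And>n. n \<ge> 1 \<Longrightarrow> folner_set H Y n (word_value H ` A n)"
    and d: "bij_betw d Y {..<card Y}" and r: "computable r"
      "\<And>n. set (list_decode (r n)) = word_code d ` A n"
    using H unfolding computable_folner_sets_wrt_def computable_word_sets_def by metis
  obtain B e q where B: "\<And>n. finite (B n)" "\<And>n. B n \<subseteq> carrier (free_group X)"
      "\<And>n. n \<ge> 1 \<Longrightarrow> folner_set N X n (word_value N ` B n)"
    and e: "bij_betw e X {..<card X}" and q: "computable q"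
      "\<And>n. set (list_decode (q n)) = word_code e ` B n"
    using N unfolding computable_folner_sets_wrt_def computable_word_sets_def by metis
  obtain C where C: "C \<ge> 1" "\<And>l l'. fst l \<in> X \<Longrightarrow> fst l' \<in> Y \<Longrightarrow>
      \<phi> (inv\<^bsub>H\<^esub> (letter_value H l')) (letter_value N l) \<in> short_elements N X C"
    using ex_distortion_constant[OF X Y] by blast
  have finZ: "finite (gens X Y)"
    using Xc Yc by (simp add: gens_def)
  then obtain z where z: "bij_betw z (gens X Y) {..<card (gens X Y)}"
    using ex_bij_betw_finite_nat atLeast0LessThan by metis
  define m where "m n = n * C ^ r n" for n
  define j where "j = (\<lambda>(u, v). map right_letter u @ map left_letter v)"
  define F where "F n = j ` (A n \<times> B (m n))" for n
  have letters: "fst ` set u \<subseteq> Y" "reduced u" if "u \<in> A n" for u n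
    using that A(2)[of n] by (auto simp: free_group_def)
  have letters': "fst ` set v \<subseteq> X" "reduced v" if "v \<in> B n" for v n
    using that B(2)[of n] by (auto simp: free_group_def)
  have F_carrier: "F n \<subseteq> carrier (free_group (gens X Y))" for n
  proof -
    have "fst ` set (map right_letter u @ map left_letter v) \<subseteq> gens X Y"
      if "u \<in> A n" "v \<in> B (m n)" for u v
      using letters(1)[OF that(1)] letters'(1)[OF that(2)]
      by (auto simp: gens_def right_letter_def left_letter_def)
    moreover have "reduced (map right_letter u @ map left_letter v)"
      if "u \<in> A n" "v \<in> B (m n)" for u v
      using letters(2)[OF that(1)] letters'(2)[OF that(2)] by (rule reduced_right_left)
    ultimately have "j p \<in> carrier (free_group (gens X Y))" if "p \<in> A n \<times> B (m n)" for p
      using that unfolding j_def free_group_def by (cases p) (simp del: set_append set_map)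
    then show ?thesis
      unfolding F_def by blast
  qed
  have F_folner: "folner_set G (gens X Y) n (word_value G ` F n)" if n: "n \<ge> 1" for n
  proof -
    have "word_value G ` F n =
        (\<lambda>(u, v). (\<phi> (word_value H u) (word_value N v), word_value H u)) ` (A n \<times> B (m n))"
    proof -
      have "word_value G (j (u, v)) = (\<phi> (word_value H u) (word_value N v), word_value H u)"
        if "u \<in> A n" "v \<in> B (m n)" for u v
        using letters(1)[OF that(1)] letters'(1)[OF that(2)] Xc Yc
        unfolding j_def prod.case by (intro word_value_right_left) auto
      then show ?thesis
        unfolding F_def image_image by (intro image_cong) auto
    qed
    also have "\<dots> = (\<lambda>(h, b). (\<phi> h b, h)) ` (word_value H ` A n \<times> word_value N ` B (m n))"
      by force
    finally have eq: "word_value G ` F n = \<dots>" .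
    have short: "\<phi> (inv\<^bsub>H\<^esub> h) x \<in> short_elements N X (C ^ r n)"
      if "x \<in> X" "h \<in> word_value H ` A n" for x h
    proof -
      obtain u where u: "u \<in> A n" "h = word_value H u"
        using \<open>h \<in> word_value H ` A n\<close> by blast
      have "word_code d u \<in> set (list_decode (r n))"
        using u r(2) by blast
      then have "length u \<le> r n"
        using mem_le_list_encode[of _ "list_decode (r n)"] length_word_code[of u d] by force
      moreover have "x \<in> short_elements N X 1"
        unfolding short_elements_def using that(1) Xc
        by (intro CollectI exI[of _ "[(x, True)]"]) (auto simp: letter_value_def)
      then have "\<phi> (inv\<^bsub>H\<^esub> h) x \<in> short_elements N X (1 * C ^ length u)"
        unfolding u(2) by (intro inv_action_short_elements[OF Xc(1) Yc(1) C(2) letters(1)[OF u(1)]])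
      ultimately show ?thesis
        using short_elements_mono[OF power_increasing[OF _ C(1)]] by fastforce
    qed
    have "m n \<ge> 1" "C ^ r n \<ge> 1"
      using n C(1) by (auto simp: m_def)
    then show ?thesis
      unfolding eq
      by (intro semidirect_folner_set[OF A(3)[OF n] B(3) Xc(1) Yc(1) m_def _ short]) auto
  qed
  have "computable_word_sets (gens X Y) F"
  proof -
    obtain s where s: "computable s" "\<And>w. fst ` set w \<subseteq> Y \<Longrightarrow>
        map s (list_decode (word_code d w)) = list_decode (word_code z (map right_letter w))"
      using ex_letter_translation[OF Yc(2) bij_betw_imp_inj_on[OF d]] by metis
    obtain t where t: "computable t" "\<And>w. fst ` set w \<subseteq> X \<Longrightarrow>
        map t (list_decode (word_code e w)) = list_decode (word_code z (map left_letter w))"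
      using ex_letter_translation[OF Xc(2) bij_betw_imp_inj_on[OF e]] by metis
    have "computable (\<lambda>n. q (m n))"
      unfolding computable_iff_recursive m_def
      by (intro recursive_computable[OF q(1)] recursive_mult recursive_power
          recursive_computable[OF r(1)] recursive_const recursive_nth) auto
    from computable_products[OF r(1) this s(1) t(1)] obtain p where p: "computable p"
      "\<And>n. set (list_decode (p n)) =
        (\<lambda>(u, v). list_encode (map s (list_decode u) @ map t (list_decode v))) `
          (set (list_decode (r n)) \<times> set (list_decode (q (m n))))"
      by blast
    have code: "list_encode (map s (list_decode (word_code d u)) @ map t (list_decode (word_code e v)))
        = word_code z (j (u, v))" if "u \<in> A n" "v \<in> B k" for u v n k
      using letters(1)[OF that(1)] letters'(1)[OF that(2)] by (simp add: s(2) t(2))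
        (simp add: word_code_def j_def)
    have "set (list_decode (p n)) = word_code z ` F n" for n
    proof -
      have "set (list_decode (p n)) = (\<lambda>(u, v). list_encode (map s (list_decode (word_code d u))
          @ map t (list_decode (word_code e v)))) ` (A n \<times> B (m n))"
        unfolding p(2) r(2) q(2) by force
      also have "\<dots> = word_code z ` F n"
        unfolding F_def image_image by (intro image_cong) (auto simp: code)
      finally show ?thesis .
    qed
    with z p(1) show ?thesis
      unfolding computable_word_sets_def by blast
  qed
  moreover have "finite (F n)" for n
    by (simp add: F_def A(1) B(1))
  ultimately show ?thesis
    unfolding computable_folner_sets_wrt_def using F_carrier F_folner by blast
qed

end

theorem corollary3p2:
  fixes N :: "('a, 'm) monoid_scheme" and H :: "('b, 'k) monoid_scheme"
    and \<phi> :: "'b \<Rightarrow> 'a \<Rightarrow> 'a"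
  assumes "group N" and "finitely_generated N" and "has_computable_folner_sets N"
    and "group H" and "finitely_generated H" and "has_computable_folner_sets H"
    and "\<phi> \<in> hom H (AutoGroup N)"
  shows "has_computable_folner_sets (semidirect N H \<phi>)"
proof -
  interpret automorphism_action N H \<phi>
    using assms by (simp add: automorphism_action_def automorphism_action_axioms_def)
  show ?thesis
    using assms(3,6) finite_generating_set_gens computable_folner_sets_semidirect
    unfolding has_computable_folner_sets_def by blast
qed

end
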